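(* For every real number $p$ with $0<p<1$, the set $$\mathcal{L}(\ell_p;\ell_p)\setminus \bigcup_{1\le s\le r<\infty}\Pi_{(r,s)}(\ell_p;\ell_p)$$ is $\mathfrak{c}$-spaceable in $\mathcal{L}(\ell_p;\ell_p)$, where the union is taken over all real numbers $r,s$ with $1\le s\le r<\infty$.
   Context: The scalar field $\mathbb{K}$ is either $\mathbb{R}$ or $\mathbb{C}$. For $0<p<1$, $\ell_p$ is the quasi-Banach space ($p$-Banach space) of all scalar sequences $x=(x_k)_{k=1}^\infty$ with $\sum_k |x_k|^p<\infty$, with quasi-norm $\|x\|_{\ell_p}=\left(\sum_{k=1}^\infty |x_k|^p\right)^{1/p}$. For Banach or quasi-Banach spaces $E,F$ over $\mathbb{K}$, $\mathcal{L}(E;F)$ denotes the space of bounded linear operators from $E$ to $F$, with the topology given by the operator quasi-norm $\|T\|=\sup_{\|x\|\le 1}\|T(x)\|$, and $E'$ denotes the topological dual of $E$. A linear operator $T:E\to F$ is absolutely $(r,s)$-summing if $\sum_{k}\|T(x_k)\|^r<\infty$ whenever $(x_k)_{k=1}^\infty$ is a sequence in $E$ such that $\sum_k |f(x_k)|^s<\infty$ for each $f\in E'$. The space of absolutely $(r,s)$-summing linear operators from $E$ to $F$ is denoted $\Pi_{(r,s)}(E;F)$. If $\alpha$ is a cardinal number and $V$ is a topological vector space, a subset $A\subseteq V$ is called $\alpha$-spaceable if $A\cup\{0\}$ contains a closed $\alpha$-dimensional linear subspace of $V$. The symbol $\mathfrak{c}$ denotes the cardinality of the continuum. *)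

theory Defs
  imports "HOL-Analysis.Analysis" "HOL-Library.Function_Algebras"
begin

unbundle cardinal_syntax

text \<open>
  Since \<open>\<ell>\<^sub>p\<close> depends on the real parameter \<open>p\<close>, quasi-normed spaces are given by a
  carrier inside an ambient type, together with a scalar multiplication and a quasi-norm.
  Addition and zero are those of the ambient type; on function types they are pointwise.
\<close>

record ('k, 'v) qspace =
  qcarrier :: "'v set"
  qscale :: "'k \<Rightarrow> 'v \<Rightarrow> 'v"
  qnorm :: "'v \<Rightarrow> real"

definition qtopology :: "('k, 'v::ab_group_add) qspace \<Rightarrow> 'v topology" where
  "qtopology E = topology (\<lambda>U. U \<subseteq> qcarrier E \<and>
     (\<forall>x\<in>U. \<exists>e>0. \<forall>y\<in>qcarrier E. qnorm E (y - x) < e \<longrightarrow> y \<in> U))"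

lemma openin_qtopology:
  "openin (qtopology E) U \<longleftrightarrow> U \<subseteq> qcarrier E \<and>
     (\<forall>x\<in>U. \<exists>e>0. \<forall>y\<in>qcarrier E. qnorm E (y - x) < e \<longrightarrow> y \<in> U)"
proof -
  have "istopology (\<lambda>U. U \<subseteq> qcarrier E \<and>
     (\<forall>x\<in>U. \<exists>e>0. \<forall>y\<in>qcarrier E. qnorm E (y - x) < e \<longrightarrow> y \<in> U))" (is "istopology ?P")
    unfolding istopology_def
  proof (intro conjI allI impI)
    fix S T assume S: "?P S" and T: "?P T"
    show "S \<inter> T \<subseteq> qcarrier E" using S by blast
    show "\<forall>x\<in>S \<inter> T. \<exists>e>0. \<forall>y\<in>qcarrier E. qnorm E (y - x) < e \<longrightarrow> y \<in> S \<inter> T"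
    proof
      fix x assume x: "x \<in> S \<inter> T"
      obtain d where d: "d > 0" "\<forall>y\<in>qcarrier E. qnorm E (y - x) < d \<longrightarrow> y \<in> S"
        using S x by blast
      obtain e where e: "e > 0" "\<forall>y\<in>qcarrier E. qnorm E (y - x) < e \<longrightarrow> y \<in> T"
        using T x by blast
      show "\<exists>e>0. \<forall>y\<in>qcarrier E. qnorm E (y - x) < e \<longrightarrow> y \<in> S \<inter> T"
        using d e by (intro exI[of _ "min d e"]) auto
    qed
  next
    fix \<K> assume K: "\<forall>U\<in>\<K>. ?P U"
    show "\<Union>\<K> \<subseteq> qcarrier E" using K by blast
    show "\<forall>x\<in>\<Union>\<K>. \<exists>e>0. \<forall>y\<in>qcarrier E. qnorm E (y - x) < e \<longrightarrow> y \<in> \<Union>\<K>"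
    proof
      fix x assume "x \<in> \<Union>\<K>"
      then obtain U where U: "U \<in> \<K>" "x \<in> U" by blast
      with K obtain e where "e > 0" "\<forall>y\<in>qcarrier E. qnorm E (y - x) < e \<longrightarrow> y \<in> U" by blast
      with U show "\<exists>e>0. \<forall>y\<in>qcarrier E. qnorm E (y - x) < e \<longrightarrow> y \<in> \<Union>\<K>" by blast
    qed
  qed
  then show ?thesis
    unfolding qtopology_def by simp
qed

lemma topspace_qtopology: "topspace (qtopology E) = qcarrier E"
proof -
  have "openin (qtopology E) (qcarrier E)"
    unfolding openin_qtopology by (auto intro: exI[of _ 1])
  then show ?thesis
    by (metis openin_qtopology openin_subset openin_topspace subset_antisym)
qed

definition scalar_space :: "('k::real_normed_field, 'k) qspace" where
  "scalar_space = \<lparr>qcarrier = UNIV, qscale = (*), qnorm = norm\<rparr>"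

text \<open>Sequences are indexed from 0.\<close>

definition ell :: "real \<Rightarrow> ('k::real_normed_field, nat \<Rightarrow> 'k) qspace" where
  "ell p =
    \<lparr>qcarrier = {x. summable (\<lambda>k. norm (x k) powr p)},
     qscale = (\<lambda>c x k. c * x k),
     qnorm = (\<lambda>x. (\<Sum>k. norm (x k) powr p) powr (1 / p))\<rparr>"

text \<open>
  A map between carriers is represented by a function on the ambient type that vanishes off the
  carrier of its domain, so that equality of operators is equality of functions and pointwise
  operations on these functions are the operations on operators.
\<close>

definition linear_operators ::
    "('k, 'v::ab_group_add) qspace \<Rightarrow> ('k, 'w::ab_group_add) qspace \<Rightarrow> ('v \<Rightarrow> 'w) set" where
  "linear_operators E F = {T.
     (\<forall>x\<in>qcarrier E. T x \<in> qcarrier F) \<and>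
     (\<forall>x\<in>qcarrier E. \<forall>y\<in>qcarrier E. T (x + y) = T x + T y) \<and>
     (\<forall>c. \<forall>x\<in>qcarrier E. T (qscale E c x) = qscale F c (T x)) \<and>
     (\<forall>x. x \<notin> qcarrier E \<longrightarrow> T x = 0)}"

definition bounded_operators ::
    "('k, 'v::ab_group_add) qspace \<Rightarrow> ('k, 'w::ab_group_add) qspace \<Rightarrow> ('k, 'v \<Rightarrow> 'w) qspace" where
  "bounded_operators E F =
    \<lparr>qcarrier = {T \<in> linear_operators E F. \<exists>C. \<forall>x\<in>qcarrier E. qnorm F (T x) \<le> C * qnorm E x},
     qscale = (\<lambda>c T x. qscale F c (T x)),
     qnorm = (\<lambda>T. SUP x\<in>{x \<in> qcarrier E. qnorm E x \<le> 1}. qnorm F (T x))\<rparr>"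

definition dual :: "('k::real_normed_field, 'v::ab_group_add) qspace \<Rightarrow> ('v \<Rightarrow> 'k) set" where
  "dual E = {f \<in> linear_operators E scalar_space. continuous_map (qtopology E) euclidean f}"

definition summing_operators :: "real \<Rightarrow> real \<Rightarrow> ('k::real_normed_field, 'v::ab_group_add) qspace \<Rightarrow>
    ('k, 'w::ab_group_add) qspace \<Rightarrow> ('v \<Rightarrow> 'w) set" where
  "summing_operators r s E F = {T \<in> linear_operators E F.
     \<forall>x. (\<forall>k::nat. x k \<in> qcarrier E) \<and> (\<forall>f\<in>dual E. summable (\<lambda>k. norm (f (x k)) powr s)) \<longrightarrow>
         summable (\<lambda>k. qnorm F (T (x k)) powr r)}"

text \<open>
  The ambient vector space of \<open>X\<close> is given by the type and the scalar multiplication \<open>smul\<close>;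
  closedness in \<open>X\<close> forces \<open>W\<close> to lie in the carrier of \<open>X\<close>. The dimension of \<open>W\<close> is the
  cardinality of a Hamel basis.
\<close>

definition spaceable :: "('k::field \<Rightarrow> 'v::ab_group_add \<Rightarrow> 'v) \<Rightarrow> 'v topology \<Rightarrow> 'c rel \<Rightarrow> 'v set \<Rightarrow> bool"
  where "spaceable smul X \<alpha> A \<longleftrightarrow>
    (\<exists>W. W \<subseteq> A \<union> {0} \<and> closedin X W \<and> module.subspace smul W \<and>
      (\<exists>B. \<not> module.dependent smul B \<and> module.span smul B = W \<and> |B| =o \<alpha>))"

lemma vector_space_bounded_operators_ell:
  "vector_space (qscale (bounded_operators E (ell p)))"
  by unfold_locales
    (auto simp: bounded_operators_def ell_def plus_fun_def fun_eq_iff algebra_simps)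

end

theory Submission
  imports Defs
begin

text \<open>
  Splitting the index set of sequences as \<open>\<nat> \<times> \<nat>\<close> turns each \<open>a \<in> \<ell>\<^sub>p\<close> into the operator
  \<open>T\<^sub>a x = a \<otimes> x\<close>, whose coordinate at \<open>(j, k)\<close> is \<open>a\<^sub>j x\<^sub>k\<close>. By Tonelli,
  \<open>\<parallel>T\<^sub>a x\<parallel> = \<parallel>a\<parallel> \<parallel>x\<parallel>\<close>, so every \<open>T\<^sub>a\<close> with \<open>a \<noteq> 0\<close> is a multiple of an
  isometric embedding (\<open>ell_tensor\<close>). The subspace sought is \<open>W = {T\<^sub>a. a \<in> \<ell>\<^sub>p}\<close>.

  No such embedding is summing, because for \<open>p < 1\<close> the dual of \<open>\<ell>\<^sub>p\<close> only sees the much smaller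
  \<open>\<ell>\<^sub>1\<close> norm. Spreading mass evenly over \<open>2\<^sup>n\<close> coordinates gives a vector of quasi-norm \<open>1\<close> with
  \<open>\<ell>\<^sub>1\<close> norm \<open>(2\<^sup>n)\<^bsup>1 - 1/p\<^esup>\<close>. Along this sequence each functional decays geometrically, hence is
  summable to every power \<open>s > 0\<close>, whereas \<open>\<parallel>T\<^sub>a x\<^sub>n\<parallel>\<close> is a nonzero constant
  (\<open>summable_dual_flat_seq\<close>, \<open>tensor_op_not_summing\<close>).

  \<open>W\<close> is closed because membership is a pointwise condition: an operator \<open>T\<close> belongs to \<open>W\<close> exactly when its
  coordinates satisfy the identities \<open>(T x)\<^bsub>(j, k)\<^esub> = (T e\<^sub>0)\<^bsub>(j, 0)\<^esub> x\<^sub>k\<close>, and both sides are continuous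
  in \<open>T\<close> (\<open>tensor_ops_characterization\<close>, \<open>closedin_tensor_ops\<close>).

  For the dimension, the geometric sequences \<open>(t\<^sup>j)\<^sub>j\<close> with \<open>|t| < 1\<close> form an independent family of
  size continuum in \<open>\<ell>\<^sub>p\<close>. Any basis of \<open>W\<close> that extends their image has at least continuum many
  elements, and at most that many since there are only continuum many scalar sequences.
\<close>
section \<open>The spaces \<open>\<ell>\<^sub>p\<close>\<close>

lemma mem_ell: "x \<in> qcarrier (ell p) \<longleftrightarrow> summable (\<lambda>k. norm (x k) powr p)"
  by (simp add: ell_def)

lemma qscale_ell: "qscale (ell p) c x = (\<lambda>k. c * x k)"
  by (simp add: ell_def)

lemma qnorm_ell: "qnorm (ell p) x = (\<Sum>k. norm (x k) powr p) powr (1 / p)"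
  by (simp add: ell_def)

lemma qnorm_ell_nonneg: "0 \<le> qnorm (ell p) x"
  by (simp add: qnorm_ell)

lemma qnorm_ell_powr:
  assumes "0 < p" "x \<in> qcarrier (ell p)"
  shows "qnorm (ell p) x powr p = (\<Sum>k. norm (x k) powr p)"
  using assms by (simp add: qnorm_ell powr_powr mem_ell suminf_nonneg)

text \<open>
  After dividing by \<open>a + b\<close> both terms lie in \<open>[0, 1]\<close>, where lowering the exponent from \<open>1\<close> to \<open>p\<close>
  can only increase a power.
\<close>
lemma powr_add_le:
  fixes a b p :: real
  assumes "0 < p" "p \<le> 1" "0 \<le> a" "0 \<le> b"
  shows "(a + b) powr p \<le> a powr p + b powr p"
proof (cases "a + b = 0")
  case False
  define s where "s = a + b"
  have s: "0 < s" using False assms by (simp add: s_def)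
  have le: "t / s \<le> (t / s) powr p" if "0 \<le> t" "t \<le> s" for t
    using powr_mono'[of p 1 "t / s"] that s assms by simp
  have "1 = a / s + b / s"
    using s by (simp add: s_def add_divide_distrib [symmetric])
  also have "\<dots> \<le> (a / s) powr p + (b / s) powr p"
    using assms by (intro add_mono le) (auto simp: s_def)
  also have "\<dots> = (a powr p + b powr p) / s powr p"
    using s assms by (simp add: powr_divide add_divide_distrib)
  finally show ?thesis
    using s by (simp add: s_def pos_le_divide_eq)
qed (use assms in auto)

lemma norm_add_powr_le:
  fixes u v :: "'k::real_normed_field"
  assumes "0 < p" "p \<le> 1"
  shows "norm (u + v) powr p \<le> norm u powr p + norm v powr p"
  using powr_mono2[of p "norm (u + v)" "norm u + norm v"]
    powr_add_le[of p "norm u" "norm v"] assms norm_triangle_ineq[of u v]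
  by (auto intro: order_trans)

text \<open>
  The \<open>p\<close>-th power of the quasi-norm is subadditive. This replaces the triangle inequality, which
  fails for the quasi-norm itself when \<open>p < 1\<close>.
\<close>
lemma ell_add:
  fixes x y :: "nat \<Rightarrow> 'k::real_normed_field"
  assumes "0 < p" "p \<le> 1" "x \<in> qcarrier (ell p)" "y \<in> qcarrier (ell p)"
  shows "x + y \<in> qcarrier (ell p)"
    and "qnorm (ell p) (x + y) powr p \<le> qnorm (ell p) x powr p + qnorm (ell p) y powr p"
proof -
  have sum: "summable (\<lambda>k. norm (x k) powr p + norm (y k) powr p)"
    using assms by (intro summable_add) (auto simp: mem_ell)
  have le: "norm ((x + y) k) powr p \<le> norm (x k) powr p + norm (y k) powr p" for k
    using norm_add_powr_le[OF assms(1,2)] by simp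
  show mem: "x + y \<in> qcarrier (ell p)"
    unfolding mem_ell by (rule summable_comparison_test'[OF sum]) (use le in auto)
  show "qnorm (ell p) (x + y) powr p \<le> qnorm (ell p) x powr p + qnorm (ell p) y powr p"
    using suminf_le[OF le mem[unfolded mem_ell] sum] assms mem
    by (simp add: qnorm_ell_powr suminf_add mem_ell)
qed

lemma ell_scale:
  fixes x :: "nat \<Rightarrow> 'k::real_normed_field"
  assumes "0 < p" "x \<in> qcarrier (ell p)"
  shows "(\<lambda>k. c * x k) \<in> qcarrier (ell p)"
    and "qnorm (ell p) (\<lambda>k. c * x k) = norm c * qnorm (ell p) x"
  using assms
  by (auto simp: mem_ell qnorm_ell norm_mult powr_mult suminf_mult suminf_nonneg powr_powr)

lemma norm_coord_le_qnorm:
  fixes x :: "nat \<Rightarrow> 'k::real_normed_field"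
  assumes "0 < p" "x \<in> qcarrier (ell p)"
  shows "norm (x i) \<le> qnorm (ell p) x"
proof -
  have "(\<Sum>k\<in>{i}. norm (x k) powr p) \<le> (\<Sum>k. norm (x k) powr p)"
    using assms by (intro sum_le_suminf) (auto simp: mem_ell)
  then have "norm (x i) powr p \<le> (\<Sum>k. norm (x k) powr p)" by simp
  then have "(norm (x i) powr p) powr (1 / p) \<le> qnorm (ell p) x"
    unfolding qnorm_ell using assms by (intro powr_mono2) auto
  then show ?thesis
    using assms by (simp add: powr_powr)
qed

lemma ell_finite_support:
  fixes x :: "nat \<Rightarrow> 'k::real_normed_field"
  assumes "finite A" "\<And>k. k \<notin> A \<Longrightarrow> x k = 0"
  shows "x \<in> qcarrier (ell p)"
    and "qnorm (ell p) x = (\<Sum>k\<in>A. norm (x k) powr p) powr (1 / p)"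
  using assms sums_finite[of A "\<lambda>k. norm (x k) powr p"]
  by (auto simp: mem_ell qnorm_ell sums_iff)

definition unit_seq :: "nat \<Rightarrow> nat \<Rightarrow> 'k::real_normed_field" where
  "unit_seq n = (\<lambda>k. if k = n then 1 else 0)"

lemma unit_seq_mem: "unit_seq n \<in> qcarrier (ell p)"
  and qnorm_unit_seq: "qnorm (ell p) (unit_seq n) = 1"
  using ell_finite_support[of "{n}" "unit_seq n" p] by (auto simp: unit_seq_def)

section \<open>Bounded operators on \<open>\<ell>\<^sub>p\<close>\<close>

abbreviation ell_operators :: "real \<Rightarrow>
    ('k::real_normed_field, (nat \<Rightarrow> 'k) \<Rightarrow> nat \<Rightarrow> 'k) qspace" where
  "ell_operators p \<equiv> bounded_operators (ell p) (ell p)"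

lemma mem_bounded_operators:
  "T \<in> qcarrier (bounded_operators E F) \<longleftrightarrow>
     T \<in> linear_operators E F \<and> (\<exists>C. \<forall>x\<in>qcarrier E. qnorm F (T x) \<le> C * qnorm E x)"
  by (simp add: bounded_operators_def)

lemma operator_mem_ell:
  assumes "T \<in> qcarrier (ell_operators p)" "x \<in> qcarrier (ell p)"
  shows "T x \<in> qcarrier (ell p)"
  using assms by (auto simp: mem_bounded_operators linear_operators_def)

text \<open>
  Neighbourhoods of \<open>T\<close> in the operator topology are measured by \<open>S - T\<close>. The operator quasi-norm is
  a real supremum, informative only for a bounded operator, so \<open>S - T\<close> has to be bounded before
  closeness of \<open>S\<close> and \<open>T\<close> says anything about their values.
\<close>
lemma operator_diff:
  fixes S T :: "(nat \<Rightarrow> 'k::real_normed_field) \<Rightarrow> nat \<Rightarrow> 'k"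
  assumes p: "0 < p" "p \<le> 1"
    and S: "S \<in> qcarrier (ell_operators p)" and T: "T \<in> qcarrier (ell_operators p)"
  shows "S - T \<in> qcarrier (ell_operators p)"
proof -
  have neg: "(\<lambda>k. - x k) \<in> qcarrier (ell p)" "qnorm (ell p) (\<lambda>k. - x k) = qnorm (ell p) x"
    if "x \<in> qcarrier (ell p)" for x :: "nat \<Rightarrow> 'k"
    using ell_scale[OF p(1) that, of "-1"] by simp_all
  have diff: "S x - T x = S x + (\<lambda>k. - T x k)" for x
    by (auto simp: fun_eq_iff)
  obtain C where C: "\<forall>x\<in>qcarrier (ell p). qnorm (ell p) (S x) \<le> C * qnorm (ell p) x"
    using S by (auto simp: mem_bounded_operators)
  obtain D where D: "\<forall>x\<in>qcarrier (ell p). qnorm (ell p) (T x) \<le> D * qnorm (ell p) x"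
    using T by (auto simp: mem_bounded_operators)
  \<comment> \<open>The multiplicativity of \<open>powr\<close> used below needs nonnegative bases.\<close>
  define c d where "c = max C 0" and "d = max D 0"
  have bound: "qnorm (ell p) (S x - T x) \<le> (c powr p + d powr p) powr (1 / p) * qnorm (ell p) x"
    if x: "x \<in> qcarrier (ell p)" for x
  proof -
    let ?N = "qnorm (ell p) x"
    have SC: "qnorm (ell p) (S x) \<le> c * ?N"
      using C x mult_right_mono[of C c ?N] qnorm_ell_nonneg[of p x] unfolding c_def by fastforce
    have TD: "qnorm (ell p) (T x) \<le> d * ?N"
      using D x mult_right_mono[of D d ?N] qnorm_ell_nonneg[of p x] unfolding d_def by fastforce
    have "qnorm (ell p) (S x - T x) powr p
        \<le> qnorm (ell p) (S x) powr p + qnorm (ell p) (T x) powr p"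
      using ell_add(2)[OF p operator_mem_ell[OF S x] neg(1)[OF operator_mem_ell[OF T x]]]
        neg(2)[OF operator_mem_ell[OF T x]]
      by (simp add: diff)
    also have "\<dots> \<le> (c * ?N) powr p + (d * ?N) powr p"
      using SC TD p by (intro add_mono powr_mono2) (auto simp: qnorm_ell_nonneg)
    also have "\<dots> = (c powr p + d powr p) * ?N powr p"
      by (simp add: powr_mult qnorm_ell_nonneg c_def d_def algebra_simps)
    finally have "(qnorm (ell p) (S x - T x) powr p) powr (1 / p)
        \<le> ((c powr p + d powr p) * ?N powr p) powr (1 / p)"
      using p by (intro powr_mono2) auto
    then show ?thesis
      using p by (simp add: powr_mult powr_powr qnorm_ell_nonneg)
  qed
  have "S - T \<in> linear_operators (ell p) (ell p)"
    unfolding linear_operators_def mem_Collect_eq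
  proof (intro conjI ballI allI impI)
    fix x assume x: "x \<in> qcarrier (ell p :: ('k, nat \<Rightarrow> 'k) qspace)"
    show "(S - T) x \<in> qcarrier (ell p)"
      using ell_add(1)[OF p operator_mem_ell[OF S x] neg(1)[OF operator_mem_ell[OF T x]]]
      by (simp add: diff)
    show "(S - T) (qscale (ell p) c x) = qscale (ell p) c ((S - T) x)" for c
      using S T x by (auto simp: mem_bounded_operators linear_operators_def qscale_ell
          fun_eq_iff algebra_simps)
    show "(S - T) (x + y) = (S - T) x + (S - T) y" if "y \<in> qcarrier (ell p)" for y
      using S T x that by (auto simp: mem_bounded_operators linear_operators_def)
  qed (use S T in \<open>auto simp: mem_bounded_operators linear_operators_def\<close>)
  then show ?thesis
    using bound by (auto simp: mem_bounded_operators)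
qed

text \<open>
  For \<open>\<parallel>x\<parallel> > 0\<close> this is homogeneity. A vector with \<open>\<parallel>x\<parallel> = 0\<close> cannot be rescaled into the unit
  ball, but there any bound \<open>C\<close> of \<open>T\<close> already forces \<open>\<parallel>T x\<parallel> \<le> C \<cdot> 0\<close>.
\<close>
lemma qnorm_operator_le:
  fixes T :: "(nat \<Rightarrow> 'k::real_normed_field) \<Rightarrow> nat \<Rightarrow> 'k"
  assumes p: "0 < p" and T: "T \<in> qcarrier (ell_operators p)" and x: "x \<in> qcarrier (ell p)"
  shows "qnorm (ell p) (T x) \<le> qnorm (ell_operators p) T * qnorm (ell p) x"
proof -
  obtain C where C: "\<And>x. x\<in>qcarrier (ell p) \<Longrightarrow> qnorm (ell p) (T x) \<le> C * qnorm (ell p) x"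
    using T by (auto simp: mem_bounded_operators)
  have ball: "qnorm (ell p) (T y) \<le> qnorm (ell_operators p) T"
    if "y \<in> qcarrier (ell p)" "qnorm (ell p) y \<le> 1" for y
  proof -
    have "bdd_above ((\<lambda>x. qnorm (ell p) (T x)) ` {x \<in> qcarrier (ell p). qnorm (ell p) x \<le> 1})"
    proof (rule bdd_aboveI2)
      fix z assume z: "z \<in> {x \<in> qcarrier (ell p :: ('k, nat \<Rightarrow> 'k) qspace). qnorm (ell p) x \<le> 1}"
      have "qnorm (ell p) (T z) \<le> C * qnorm (ell p) z" using z C by blast
      also have "\<dots> \<le> max C 0 * 1"
        using z by (intro mult_mono) (auto simp: qnorm_ell_nonneg)
      finally show "qnorm (ell p) (T z) \<le> max C 0 * 1" .
    qed
    then show ?thesis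
      unfolding bounded_operators_def using that by (auto intro!: cSUP_upper)
  qed
  show ?thesis
  proof (cases "qnorm (ell p) x = 0")
    case True
    then show ?thesis using C[OF x] by simp
  next
    case False
    define N where "N = qnorm (ell p) x"
    have N: "0 < N" using False qnorm_ell_nonneg[of p x] by (simp add: N_def)
    define y where "y = (\<lambda>k. of_real (1 / N) * x k)"
    have y: "y \<in> qcarrier (ell p)" "qnorm (ell p) y = 1"
      using ell_scale[OF p x, of "of_real (1 / N)"] N
      by (simp_all add: y_def N_def [symmetric] norm_divide)
    have "T y = (\<lambda>k. of_real (1 / N) * T x k)"
      using T x unfolding y_def mem_bounded_operators linear_operators_def qscale_ell by blast
    then have "qnorm (ell p) (T y) = qnorm (ell p) (T x) / N"
      using ell_scale(2)[OF p operator_mem_ell[OF T x], of "of_real (1 / N)"] N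
      by (simp add: norm_divide)
    then show ?thesis
      using ball[OF y(1)] y(2) N by (simp add: N_def [symmetric] pos_divide_le_eq)
  qed
qed

text \<open>Each scalar coordinate \<open>(T x)\<^sub>i\<close> depends continuously on \<open>T\<close>, with an explicit modulus.\<close>
lemma norm_coord_diff_le:
  fixes S T :: "(nat \<Rightarrow> 'k::real_normed_field) \<Rightarrow> nat \<Rightarrow> 'k"
  assumes "0 < p" "p \<le> 1" "S \<in> qcarrier (ell_operators p)" "T \<in> qcarrier (ell_operators p)"
    and x: "x \<in> qcarrier (ell p)"
  shows "norm (S x i - T x i) \<le> qnorm (ell_operators p) (S - T) * qnorm (ell p) x"
  using norm_coord_le_qnorm[OF \<open>0 < p\<close> operator_mem_ell[OF operator_diff[OF assms(1-4)] x], of i]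
    qnorm_operator_le[OF \<open>0 < p\<close> operator_diff[OF assms(1-4)] x] by simp

section \<open>Tensor operators\<close>

text \<open>The elementary tensor \<open>a \<otimes> x\<close>, a double sequence listed as a sequence by the pairing function.\<close>
definition tensor :: "(nat \<Rightarrow> 'k::real_normed_field) \<Rightarrow> (nat \<Rightarrow> 'k) \<Rightarrow> nat \<Rightarrow> 'k" where
  "tensor a x = (\<lambda>i. a (fst (prod_decode i)) * x (snd (prod_decode i)))"

lemma tensor_prod_encode [simp]: "tensor a x (prod_encode (j, k)) = a j * x k"
  by (simp add: tensor_def)

lemma sums_prod_decode:
  fixes f g :: "nat \<Rightarrow> real"
  assumes "f sums A" "g sums B" "\<And>n. 0 \<le> f n" "\<And>n. 0 \<le> g n"
  shows "(\<lambda>i. f (fst (prod_decode i)) * g (snd (prod_decode i))) sums (A * B)"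
proof -
  have f: "(f has_sum A) UNIV" and g: "(g has_sum B) UNIV"
    using assms by (auto intro: sums_nonneg_imp_has_sum)
  have row: "((\<lambda>k. f j * g k) has_sum f j * B) UNIV" for j
    using has_sum_cmult_right[OF g] .
  have col: "((\<lambda>j. f j * B) has_sum A * B) UNIV"
    using has_sum_cmult_left[OF f] .
  have "(\<lambda>(j, k). f j * g k) summable_on (UNIV \<times> UNIV)"
    using row col assms by (intro summable_on_SigmaI[where g = "\<lambda>j. f j * B"])
      (auto simp: summable_on_def)
  then have "((\<lambda>(j, k). f j * g k) has_sum A * B) (UNIV \<times> UNIV)"
    using row col by (intro has_sum_SigmaI[where g = "\<lambda>j. f j * B"]) auto
  then have "((\<lambda>i. (\<lambda>(j, k). f j * g k) (prod_decode i)) has_sum A * B) UNIV"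
    by (subst has_sum_reindex_bij_betw[OF bij_prod_decode]) simp
  then show ?thesis
    by (auto dest!: has_sum_imp_sums simp: case_prod_beta)
qed

text \<open>
  The quasi-norm is multiplicative because \<open>\<Sum>\<^bsub>j,k\<^esub> |a\<^sub>j x\<^sub>k|\<^sup>p\<close> factors into the two single sums.
\<close>
lemma ell_tensor:
  fixes a x :: "nat \<Rightarrow> 'k::real_normed_field"
  assumes "0 < p" "a \<in> qcarrier (ell p)" "x \<in> qcarrier (ell p)"
  shows "tensor a x \<in> qcarrier (ell p)"
    and "qnorm (ell p) (tensor a x) = qnorm (ell p) a * qnorm (ell p) x"
proof -
  have "(\<lambda>i. norm (tensor a x i) powr p)
      sums ((\<Sum>k. norm (a k) powr p) * (\<Sum>k. norm (x k) powr p))"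
    using sums_prod_decode[of "\<lambda>k. norm (a k) powr p" _ "\<lambda>k. norm (x k) powr p"] assms
    by (simp add: tensor_def norm_mult powr_mult mem_ell summable_sums)
  then show "tensor a x \<in> qcarrier (ell p)"
    "qnorm (ell p) (tensor a x) = qnorm (ell p) a * qnorm (ell p) x"
    using assms by (auto simp: mem_ell qnorm_ell sums_iff powr_mult suminf_nonneg)
qed

text \<open>Operators vanish off the carrier of their domain, hence the case distinction.\<close>
definition tensor_op :: "real \<Rightarrow> (nat \<Rightarrow> 'k::real_normed_field) \<Rightarrow> (nat \<Rightarrow> 'k) \<Rightarrow> nat \<Rightarrow> 'k" where
  "tensor_op p a = (\<lambda>x. if x \<in> qcarrier (ell p) then tensor a x else 0)"

lemma tensor_op_bounded:
  fixes a :: "nat \<Rightarrow> 'k::real_normed_field"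
  assumes "0 < p" "p \<le> 1" "a \<in> qcarrier (ell p)"
  shows "tensor_op p a \<in> qcarrier (ell_operators p)"
proof -
  have "tensor_op p a \<in> linear_operators (ell p) (ell p)"
    using assms
    by (auto simp: linear_operators_def tensor_op_def ell_tensor qscale_ell ell_add(1) ell_scale(1))
      (auto simp: tensor_def fun_eq_iff algebra_simps)
  then show ?thesis
    using assms
    by (auto simp: mem_bounded_operators tensor_op_def ell_tensor
        intro!: exI[of _ "qnorm (ell p) a"])
qed

text \<open>
  If the identities hold, then \<open>a\<^sub>j = (T e\<^sub>0)\<^bsub>(j, 0)\<^esub>\<close> recovers the symbol of \<open>T\<close>. It lies in \<open>\<ell>\<^sub>p\<close>
  because it is a subsequence of \<open>T e\<^sub>0 \<in> \<ell>\<^sub>p\<close>.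
\<close>
lemma tensor_ops_characterization:
  fixes T :: "(nat \<Rightarrow> 'k::real_normed_field) \<Rightarrow> nat \<Rightarrow> 'k"
  assumes "0 < p" "p \<le> 1"
  shows "T \<in> tensor_op p ` qcarrier (ell p) \<longleftrightarrow>
    T \<in> qcarrier (ell_operators p) \<and>
    (\<forall>x\<in>qcarrier (ell p). \<forall>j k.
       T x (prod_encode (j, k)) = T (unit_seq 0) (prod_encode (j, 0)) * x k)"
    (is "?L \<longleftrightarrow> ?B \<and> ?R")
proof
  assume ?L
  then show "?B \<and> ?R"
    using tensor_op_bounded[OF assms]
    by (auto simp: tensor_op_def unit_seq_mem) (auto simp: unit_seq_def)
next
  assume BR: "?B \<and> ?R"
  define a where "a = (\<lambda>j. T (unit_seq 0) (prod_encode (j, 0)))"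
  have T0: "summable (\<lambda>i. norm (T (unit_seq 0) i) powr p)"
    using BR operator_mem_ell[OF _ unit_seq_mem] by (auto simp: mem_ell)
  have "inj (\<lambda>j. prod_encode (j, 0))"
    by (auto intro: injI)
  then have a: "a \<in> qcarrier (ell p)"
    using summable_reindex(1)[OF T0, of "\<lambda>j. prod_encode (j, 0)"]
    by (simp add: mem_ell a_def o_def)
  have "T x = tensor_op p a x" for x
  proof (cases "x \<in> qcarrier (ell p)")
    case True
    have "T x i = tensor a x i" for i
      using BR True by (cases "prod_decode i")
        (metis a_def prod_decode_inverse tensor_prod_encode)
    with True show ?thesis by (simp add: tensor_op_def fun_eq_iff)
  next
    case False
    then show ?thesis
      using BR by (auto simp: tensor_op_def mem_bounded_operators linear_operators_def)
  qed
  with a show ?L by blast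
qed

lemma closedin_tensor_ops:
  assumes p: "0 < p" "p \<le> 1"
  shows "closedin (qtopology (ell_operators p :: ('k::real_normed_field, _) qspace))
    (tensor_op p ` qcarrier (ell p))" (is "closedin (qtopology ?L) ?W")
proof -
  have sub: "?W \<subseteq> qcarrier ?L"
    using tensor_op_bounded[OF p] by auto
  have "\<exists>e>0. \<forall>S\<in>qcarrier ?L. qnorm ?L (S - T) < e \<longrightarrow> S \<in> qcarrier ?L - ?W"
    if T: "T \<in> qcarrier ?L - ?W" for T
  proof -
    let ?e0 = "unit_seq 0 :: nat \<Rightarrow> 'k"
    obtain x j k where x: "x \<in> qcarrier (ell p)"
      and ne: "T x (prod_encode (j, k)) \<noteq> T ?e0 (prod_encode (j, 0)) * x k"
      using T tensor_ops_characterization[OF p, of T] by blast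
    \<comment> \<open>If \<open>T\<close> violates an identity by \<open>d\<close>, then any \<open>S\<close> satisfying it is at distance at least \<open>d / M\<close>:
        the left side moves by at most \<open>\<parallel>S - T\<parallel> \<parallel>x\<parallel>\<close> and the right side by at most \<open>\<parallel>S - T\<parallel> |x\<^sub>k|\<close>,
        as \<open>\<parallel>e\<^sub>0\<parallel> = 1\<close>. The summand \<open>1\<close> in \<open>M\<close> keeps it positive.\<close>
    define d where "d = norm (T x (prod_encode (j, k)) - T ?e0 (prod_encode (j, 0)) * x k)"
    define M where "M = qnorm (ell p) x + norm (x k) + 1"
    have d: "0 < d" using ne by (simp add: d_def)
    have M: "0 < M" using qnorm_ell_nonneg[of p x] by (simp add: M_def add_nonneg_pos)
    have "S \<notin> ?W" if S: "S \<in> qcarrier ?L" and near: "qnorm ?L (S - T) < d / M" for S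
    proof
      assume "S \<in> ?W"
      then have Sx: "S x (prod_encode (j, k)) = S ?e0 (prod_encode (j, 0)) * x k"
        using tensor_ops_characterization[OF p, of S] x by blast
      let ?n = "qnorm ?L (S - T)"
      have 1: "norm (S x (prod_encode (j, k)) - T x (prod_encode (j, k))) \<le> ?n * qnorm (ell p) x"
        using norm_coord_diff_le[OF p S _ x] T by blast
      have 2: "norm (S ?e0 (prod_encode (j, 0)) - T ?e0 (prod_encode (j, 0))) \<le> ?n"
        using norm_coord_diff_le[OF p S _ unit_seq_mem, of T 0 "prod_encode (j, 0)"] T
        by (simp add: qnorm_unit_seq)
      have n: "0 \<le> ?n" using 2 by (meson norm_ge_zero order_trans)
      have "d = norm ((S ?e0 (prod_encode (j, 0)) - T ?e0 (prod_encode (j, 0))) * x k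
          - (S x (prod_encode (j, k)) - T x (prod_encode (j, k))))"
        unfolding d_def Sx by (simp add: algebra_simps)
      also have "\<dots> \<le> norm (S ?e0 (prod_encode (j, 0)) - T ?e0 (prod_encode (j, 0))) * norm (x k)
          + norm (S x (prod_encode (j, k)) - T x (prod_encode (j, k)))"
        by (metis norm_mult norm_triangle_ineq4)
      also have "\<dots> \<le> ?n * norm (x k) + ?n * qnorm (ell p) x"
        using 1 2 by (intro add_mono mult_right_mono) auto
      also have "\<dots> \<le> ?n * M"
        using n by (simp add: M_def algebra_simps)
      also have "\<dots> < d"
        using near M by (simp add: pos_less_divide_eq)
      finally show False by simp
    qed
    then show ?thesis
      using d M by (intro exI[of _ "d / M"]) auto
  qed
  then show ?thesis
    using sub unfolding closedin_def topspace_qtopology openin_qtopology by auto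
qed

section \<open>Failure of summability\<close>

text \<open>
  Unit mass of \<open>\<ell>\<^sub>p\<close> spread evenly over the first \<open>2\<^sup>n\<close> coordinates. The block length is exponential in
  \<open>n\<close> so that the \<open>\<ell>\<^sub>1\<close> norms decay geometrically.
\<close>
definition flat_seq :: "real \<Rightarrow> nat \<Rightarrow> nat \<Rightarrow> 'k::real_normed_field" where
  "flat_seq p n = (\<lambda>k. if k < 2 ^ n then of_real ((2 ^ n) powr (- 1 / p)) else 0)"

lemma flat_seq_mem: "flat_seq p n \<in> qcarrier (ell p)"
  by (rule ell_finite_support[of "{..<2 ^ n}"]) (auto simp: flat_seq_def)

lemma qnorm_flat_seq: "0 < p \<Longrightarrow> qnorm (ell p) (flat_seq p n :: nat \<Rightarrow> 'k::real_normed_field) = 1"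
  by (subst ell_finite_support(2)[of "{..<2 ^ n}"])
    (auto simp: flat_seq_def powr_powr powr_minus_divide powr_divide norm_divide)

text \<open>
  Continuity at \<open>0\<close> gives some \<open>e > 0\<close> with \<open>|f y| < 1\<close> for \<open>\<parallel>y\<parallel> < e\<close>; testing on half-size
  multiples \<open>(e / 2) e\<^sub>k\<close> yields the uniform bound \<open>2 / e\<close>. This is the inclusion of the dual of
  \<open>\<ell>\<^sub>p\<close> in \<open>\<ell>\<^sub>\<infinity>\<close>.
\<close>
lemma dual_bounded_on_units:
  assumes p: "0 < p" and f: "f \<in> dual (ell p :: ('k::real_normed_field, nat \<Rightarrow> 'k) qspace)"
  obtains C where "0 \<le> C" "\<And>k. norm (f (unit_seq k)) \<le> C"
proof -
  have cont: "continuous_map (qtopology (ell p :: ('k, nat \<Rightarrow> 'k) qspace)) euclidean f"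
    and lin: "\<And>c x. x \<in> qcarrier (ell p) \<Longrightarrow> f (\<lambda>k. c * x k) = c * f x"
    using f by (auto simp: dual_def linear_operators_def scalar_space_def qscale_ell)
  let ?z = "\<lambda>k. 0 :: 'k"
  have z: "?z \<in> qcarrier (ell p)" by (simp add: mem_ell)
  have fz: "f ?z = 0" using lin[OF z, of 0] by simp
  have "openin (qtopology (ell p)) {x \<in> topspace (qtopology (ell p)). f x \<in> ball 0 1}"
    by (rule openin_continuous_map_preimage[OF cont]) simp
  moreover have "?z \<in> {x \<in> topspace (qtopology (ell p)). f x \<in> ball 0 1}"
    using z fz by (simp add: topspace_qtopology)
  ultimately obtain e where e: "0 < e"
    "\<forall>y\<in>qcarrier (ell p). qnorm (ell p) (y - ?z) < e \<longrightarrow>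
       y \<in> {x \<in> topspace (qtopology (ell p)). f x \<in> ball 0 1}"
    unfolding openin_qtopology by blast
  have "norm (f (unit_seq k)) \<le> 2 / e" for k
  proof -
    let ?y = "\<lambda>i. of_real (e / 2) * unit_seq k i :: 'k"
    have y: "?y \<in> qcarrier (ell p)" "qnorm (ell p) ?y = e / 2"
      using ell_scale[OF p unit_seq_mem, of "of_real (e / 2)" k] e(1)
      by (auto simp: qnorm_unit_seq)
    have "?y - ?z = ?y" by (auto simp: fun_eq_iff)
    then have "norm (f ?y) < 1"
      using e(1) bspec[OF e(2) y(1)] y(2) by simp
    moreover have "f ?y = of_real (e / 2) * f (unit_seq k)"
      by (rule lin[OF unit_seq_mem])
    ultimately show ?thesis
      using e(1) by (simp add: norm_mult norm_divide pos_le_divide_eq mult.commute del: of_real_divide)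
  qed
  then show thesis using e(1) by (intro that[of "2 / e"]) auto
qed

text \<open>
  On a finitely supported vector, linearity bounds \<open>|f x|\<close> by \<open>C \<parallel>x\<parallel>\<^sub>1\<close>, and
  \<open>2\<^sup>n \<cdot> (2\<^sup>n)\<^bsup>-1/p\<^esup> = (2\<^bsup>1 - 1/p\<^esup>)\<^sup>n\<close>.
\<close>
lemma dual_flat_seq_le:
  fixes f :: "(nat \<Rightarrow> 'k::real_normed_field) \<Rightarrow> 'k"
  assumes p: "0 < p" "p \<le> 1" and f: "f \<in> dual (ell p)"
  obtains C where "0 \<le> C" "\<And>n. norm (f (flat_seq p n)) \<le> C * (2 powr (1 - 1 / p)) ^ n"
proof -
  obtain C where C: "0 \<le> C" "\<And>k. norm (f (unit_seq k)) \<le> C"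
    using dual_bounded_on_units[OF p(1) f] by blast
  have add: "\<And>x y. x \<in> qcarrier (ell p) \<Longrightarrow> y \<in> qcarrier (ell p) \<Longrightarrow> f (x + y) = f x + f y"
    and lin: "\<And>c x. x \<in> qcarrier (ell p) \<Longrightarrow> f (\<lambda>k. c * x k) = c * f x"
    using f by (auto simp: dual_def linear_operators_def scalar_space_def qscale_ell)
  have block: "norm (f (\<lambda>k. if k < m then c else 0)) \<le> C * (norm c * real m)" for m and c :: 'k
  proof (induction m)
    case 0
    have "(\<lambda>k::nat. 0::'k) \<in> qcarrier (ell p)" by (simp add: mem_ell)
    from lin[OF this, of 0] show ?case by simp
  next
    case (Suc m)
    let ?x = "\<lambda>k. if k < m then c else 0"
    have x: "?x \<in> qcarrier (ell p)"
      by (rule ell_finite_support[of "{..<m}"]) auto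
    have "(\<lambda>k. if k < Suc m then c else 0) = ?x + (\<lambda>k. c * unit_seq m k)"
      by (auto simp: fun_eq_iff unit_seq_def)
    then have "f (\<lambda>k. if k < Suc m then c else 0) = f ?x + c * f (unit_seq m)"
      using add[OF x ell_scale(1)[OF p(1) unit_seq_mem]] lin[OF unit_seq_mem] by simp
    also have "norm \<dots> \<le> C * (norm c * real m) + norm c * C"
      using Suc C by (intro norm_triangle_le add_mono) (auto simp: norm_mult intro: mult_left_mono)
    finally show ?case by (simp add: algebra_simps)
  qed
  have "norm (f (flat_seq p n)) \<le> C * (2 powr (1 - 1 / p)) ^ n" for n
  proof -
    have "norm (of_real ((2 ^ n) powr (- 1 / p)) :: 'k) * real (2 ^ n)
        = (2 ^ n) powr 1 * (2 ^ n) powr (- 1 / p)"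
      by simp
    also have "\<dots> = (2 ^ n) powr (1 - 1 / p)"
      by (subst powr_add [symmetric]) simp
    also have "\<dots> = (2 powr (1 - 1 / p)) ^ n"
      by (simp add: powr_realpow [symmetric] powr_powr mult.commute)
    finally show ?thesis
      using block[of "2 ^ n" "of_real ((2 ^ n) powr (- 1 / p))"] by (simp add: flat_seq_def)
  qed
  with C(1) show thesis by (rule that)
qed

text \<open>This is where \<open>p < 1\<close> is essential: the ratio \<open>2\<^bsup>1 - 1/p\<^esup>\<close> is then less than \<open>1\<close>.\<close>
lemma summable_dual_flat_seq:
  fixes f :: "(nat \<Rightarrow> 'k::real_normed_field) \<Rightarrow> 'k"
  assumes p: "0 < p" "p < 1" and s: "0 < s" and f: "f \<in> dual (ell p)"
  shows "summable (\<lambda>n. norm (f (flat_seq p n)) powr s)"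
proof -
  define q where "q = 2 powr (1 - 1 / p)"
  obtain C where C: "0 \<le> C" "\<And>n. norm (f (flat_seq p n)) \<le> C * q ^ n"
    using dual_flat_seq_le[OF p(1) less_imp_le[OF p(2)] f] unfolding q_def by blast
  have q: "0 < q" "q < 1"
    using p powr_less_mono[of "1 - 1 / p" 0 2] by (auto simp: q_def)
  have "q powr s < 1" using powr_less_mono2[of s q 1] s q by simp
  then have "summable (\<lambda>n. C powr s * (q powr s) ^ n)"
    by (intro summable_mult summable_geometric) simp
  then show ?thesis
  proof (rule summable_comparison_test')
    fix n
    have "norm (f (flat_seq p n)) powr s \<le> (C * q ^ n) powr s"
      using C s by (intro powr_mono2) auto
    also have "\<dots> = C powr s * (q powr s) ^ n"
      using q C(1) by (simp add: powr_mult powr_realpow [symmetric] powr_powr mult.commute)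
    finally show "norm (norm (f (flat_seq p n)) powr s) \<le> C powr s * (q powr s) ^ n" by simp
  qed
qed

text \<open>
  The flat sequences satisfy the hypothesis of \<open>(r, s)\<close>-summability, but their images all have
  quasi-norm \<open>\<parallel>a\<parallel>\<close>. Constant series are summable only if the constant vanishes, for every exponent \<open>r\<close>.
\<close>
lemma tensor_op_not_summing:
  fixes a :: "nat \<Rightarrow> 'k::real_normed_field"
  assumes p: "0 < p" "p < 1" and a: "a \<in> qcarrier (ell p)" and nz: "tensor_op p a \<noteq> 0"
    and s: "0 < s"
  shows "tensor_op p a \<notin> summing_operators r s (ell p) (ell p)"
proof
  assume "tensor_op p a \<in> summing_operators r s (ell p) (ell p)"
  then have "summable (\<lambda>n. qnorm (ell p) (tensor_op p a (flat_seq p n)) powr r)"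
    using summable_dual_flat_seq[OF p s, where 'k = 'k] flat_seq_mem[of p, where 'a = 'k]
    unfolding summing_operators_def by blast
  moreover have "qnorm (ell p) (tensor_op p a (flat_seq p n)) = qnorm (ell p) a" for n
    using p a by (simp add: tensor_op_def flat_seq_mem ell_tensor qnorm_flat_seq)
  ultimately have "summable (\<lambda>n :: nat. qnorm (ell p) a powr r)" by simp
  then have "qnorm (ell p) a = 0" by (simp only: summable_const_iff powr_eq_0_iff)
  then have "norm (a j) \<le> 0" for j
    using norm_coord_le_qnorm[OF p(1) a, of j] by simp
  then have "tensor_op p a = 0"
    by (auto simp: tensor_op_def tensor_def fun_eq_iff)
  with nz show False by contradiction
qed

section \<open>Dimension\<close>

text \<open>
  Geometric sequences are eigenvectors of the shift for distinct eigenvalues: applying the shift minus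
  \<open>s\<close> to a relation removes the term of ratio \<open>s\<close> and multiplies the others by the nonzero \<open>t - s\<close>.
\<close>
lemma geometric_seqs_independent:
  fixes u :: "'k::field \<Rightarrow> 'k"
  assumes "finite F" "\<And>j. (\<Sum>t\<in>F. u t * t ^ j) = 0" "t \<in> F"
  shows "u t = 0"
  using assms
proof (induction F arbitrary: u t rule: finite_induct)
  case (insert s F)
  have F: "u t = 0" if t: "t \<in> F" for t
  proof -
    have "(\<Sum>t\<in>F. (u t * (t - s)) * t ^ j) = 0" for j
    proof -
      have "(\<Sum>t\<in>F. (u t * (t - s)) * t ^ j) = (\<Sum>t\<in>insert s F. (u t * (t - s)) * t ^ j)"
        using insert.hyps by simp
      also have "\<dots> = (\<Sum>t\<in>insert s F. u t * t ^ Suc j) - s * (\<Sum>t\<in>insert s F. u t * t ^ j)"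
        by (simp only: sum_distrib_left sum_subtractf [symmetric]) (simp add: algebra_simps)
      finally show ?thesis by (simp only: insert.prems(1)) simp
    qed
    from insert.IH[OF this t] show ?thesis
      using t insert.hyps by auto
  qed
  moreover have "u s = 0"
    using insert.prems(1)[of 0] F insert.hyps by simp
  ultimately show ?case using insert.prems(2) by auto
qed simp

lemma geometric_seq_mem_ell:
  fixes t :: "'k::real_normed_field"
  assumes "0 < p" "norm t < 1"
  shows "(\<lambda>j. t ^ j) \<in> qcarrier (ell p)"
proof (cases "t = 0")
  case True
  then show ?thesis
    using ell_finite_support(1)[of "{0}" "\<lambda>j. t ^ j" p] by simp
next
  case False
  have "norm t powr p < 1" using powr_less_mono2[of p "norm t" 1] assms by simp
  moreover have "norm (t ^ j) powr p = (norm t powr p) ^ j" for j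
    using False by (simp add: norm_power powr_realpow [symmetric] powr_powr mult.commute)
  ultimately show ?thesis by (simp add: mem_ell summable_geometric)
qed

lemma sum_fun_apply:
  fixes f :: "'a \<Rightarrow> 'b \<Rightarrow> 'c::comm_monoid_add"
  shows "(\<Sum>i\<in>F. f i) x = (\<Sum>i\<in>F. f i x)"
  by (induction F rule: infinite_finite_induct) auto

lemma qscale_ell_operators: "qscale (ell_operators p) c T = (\<lambda>x k. c * T x k)"
  by (simp add: bounded_operators_def qscale_ell)

text \<open>The symbol \<open>a\<close> can be read off from the operator, so \<open>a \<mapsto> T\<^sub>a\<close> is injective.\<close>
lemma tensor_op_unit_seq: "tensor_op p a (unit_seq 0) (prod_encode (j, 0)) = a j"
  by (simp add: tensor_op_def unit_seq_mem) (simp add: unit_seq_def)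

lemma tensor_op_inj: "inj (tensor_op p :: (nat \<Rightarrow> 'k::real_normed_field) \<Rightarrow> _)"
  by (rule injI) (metis tensor_op_unit_seq ext)

text \<open>
  The scalar field enters only through its cardinality: the embedding \<open>g\<close> says that there are at most
  continuum many scalar sequences, which bounds the dimension from above.
\<close>
lemma spaceable_non_summing:
  fixes p :: real and g :: "(nat \<Rightarrow> 'k::real_normed_field) \<Rightarrow> real"
  assumes p: "0 < p" "p < 1" and g: "inj g"
  defines "L \<equiv> ell_operators p :: ('k, _) qspace"
  shows "spaceable (qscale L) (qtopology L) |UNIV :: real set|
    (qcarrier L - \<Union>{summing_operators r s (ell p) (ell p) | r s. 1 \<le> s \<and> s \<le> r})"
proof -
  interpret V: vector_space "qscale L"
    unfolding L_def by (rule vector_space_bounded_operators_ell)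
  have p1: "p \<le> 1" using p by simp
  define W where "W = tensor_op p ` qcarrier (ell p :: ('k, nat \<Rightarrow> 'k) qspace)"
  have closed: "closedin (qtopology L) W"
    unfolding W_def L_def by (rule closedin_tensor_ops[OF p(1) p1])
  have avoids: "W \<subseteq> (qcarrier L - \<Union>{summing_operators r s (ell p) (ell p) | r s. 1 \<le> s \<and> s \<le> r}) \<union> {0}"
    using tensor_op_bounded[OF p(1) p1] tensor_op_not_summing[OF p]
    unfolding W_def L_def by fastforce
  have subspace: "V.subspace W"
  proof (rule V.subspaceI)
    have "(\<lambda>k. 0) \<in> qcarrier (ell p)" "tensor_op p (\<lambda>k. 0 :: 'k) = 0"
      by (auto simp: mem_ell tensor_op_def tensor_def fun_eq_iff)
    then show "0 \<in> W" unfolding W_def by (metis image_eqI)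
  next
    fix S T assume "S \<in> W" "T \<in> W"
    then obtain a b where ab: "a \<in> qcarrier (ell p)" "b \<in> qcarrier (ell p)"
      "S = tensor_op p a" "T = tensor_op p b" unfolding W_def by blast
    then have "S + T = tensor_op p (a + b)"
      by (auto simp: tensor_op_def tensor_def fun_eq_iff algebra_simps)
    then show "S + T \<in> W" unfolding W_def using ell_add(1)[OF p(1) p1] ab by blast
  next
    fix c T assume "T \<in> W"
    then obtain a where a: "a \<in> qcarrier (ell p)" "T = tensor_op p a" unfolding W_def by blast
    then have "qscale L c T = tensor_op p (\<lambda>k. c * a k)"
      by (auto simp: tensor_op_def tensor_def fun_eq_iff algebra_simps qscale_ell_operators L_def)
    then show "qscale L c T \<in> W" unfolding W_def using ell_scale(1)[OF p(1)] a by blast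
  qed
  define h :: "'k \<Rightarrow> _" where "h = (\<lambda>t. tensor_op p (\<lambda>j. t ^ j))"
  have h_eval: "h t (unit_seq 0) (prod_encode (j, 0)) = t ^ j" for t j
    by (simp add: h_def tensor_op_unit_seq)
  have h_inj: "inj h"
    by (rule injI) (metis h_eval power_one_right)
  define I where "I = {t :: 'k. norm t < 1}"
  have h_W: "h ` I \<subseteq> W"
    using geometric_seq_mem_ell[OF p(1)] by (auto simp: h_def I_def W_def)
  have indep: "V.independent (h ` I)"
  proof
    assume "V.dependent (h ` I)"
    then obtain G u v where G: "finite G" "G \<subseteq> h ` I"
      and 0: "(\<Sum>v\<in>G. qscale L (u v) v) = 0" and v: "v \<in> G" "u v \<noteq> 0"
      unfolding V.dependent_explicit by auto
    obtain F where F: "F \<subseteq> I" "finite F" "G = h ` F"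
      using G finite_subset_image by metis
    obtain t where t: "t \<in> F" "v = h t"
      using v(1) F(3) by auto
    have "(\<Sum>t\<in>F. u (h t) * t ^ j) = 0" for j
    proof -
      have "(\<Sum>t\<in>F. u (h t) * t ^ j) = (\<Sum>v\<in>G. qscale L (u v) v) (unit_seq 0) (prod_encode (j, 0))"
        unfolding F(3) using h_inj
        by (simp add: sum.reindex inj_on_subset sum_fun_apply qscale_ell_operators L_def h_eval)
      then show ?thesis by (simp add: 0)
    qed
    from geometric_seqs_independent[OF F(2) this t(1)] show False
      using v(2) t(2) by simp
  qed
  obtain B where B: "h ` I \<subseteq> B" "B \<subseteq> W" "V.independent B" "W \<subseteq> V.span B"
    by (rule V.maximal_independent_subset_extend[OF h_W indep])
  have span: "V.span B = W"
    using V.span_minimal[OF B(2) subspace] B(4) by (rule subset_antisym)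
  have "|B| \<le>o |UNIV :: real set|"
  proof -
    have "inj_on (g \<circ> inv (tensor_op p)) W"
      unfolding W_def using g tensor_op_inj[of p, where 'k = 'k]
      by (auto intro!: inj_onI simp: inv_f_f dest: injD)
    then show ?thesis
      using B(2) by (meson card_of_ordLeq inj_on_subset subset_UNIV)
  qed
  moreover have "|UNIV :: real set| \<le>o |B|"
  proof -
    \<comment> \<open>Embed \<open>\<real>\<close> into the unit ball of scalars, which indexes the independent family.\<close>
    define i :: "real \<Rightarrow> 'k" where "i = (\<lambda>x. of_real (1 / (1 + exp x)))"
    have "i x \<in> I" for x
      by (simp add: i_def I_def add_pos_pos norm_divide abs_of_pos del: of_real_divide of_real_add)
    moreover have "inj i"
    proof (rule injI)
      fix x y assume "i x = i y"
      then have "1 / (1 + exp x) = 1 / (1 + exp y)" unfolding i_def of_real_eq_iff .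
      then have "1 + exp x = 1 + exp y" by (metis inverse_eq_divide inverse_inverse_eq)
      then show "x = y" by simp
    qed
    ultimately have "inj (h \<circ> i)" "range (h \<circ> i) \<subseteq> B"
      using h_inj B(1) by (auto intro: inj_compose)
    then show ?thesis by (meson card_of_ordLeq)
  qed
  ultimately have "|B| =o |UNIV :: real set|"
    by (simp add: ordIso_iff_ordLeq)
  then show ?thesis
    unfolding spaceable_def using avoids closed subspace B(3) span by blast
qed

text \<open>
  Reals correspond to sets of naturals, and a sequence of such sets is a subset of
  \<open>\<nat> \<times> \<nat>\<close>, which the pairing function turns into a single set of naturals.
\<close>
lemma real_seqs_inj_real: "\<exists>g :: (nat \<Rightarrow> real) \<Rightarrow> real. inj g"
proof -
  obtain b :: "real \<Rightarrow> nat set" where b: "inj b"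
    using nat_sets_eqpoll_reals eqpoll_sym unfolding eqpoll_def bij_betw_def by blast
  obtain c :: "nat set \<Rightarrow> real" where c: "inj c"
    using nat_sets_eqpoll_reals unfolding eqpoll_def bij_betw_def by blast
  define d where "d = (\<lambda>a :: nat \<Rightarrow> real. prod_encode ` (SIGMA j:UNIV. b (a j)))"
  have "inj d"
  proof (rule injI)
    fix x y assume "d x = d y"
    then have "(SIGMA j:UNIV. b (x j)) = (SIGMA j:UNIV. b (y j))"
      unfolding d_def by (simp add: inj_image_eq_iff inj_prod_encode)
    then have "b (x j) = b (y j)" for j by blast
    then show "x = y" by (simp add: fun_eq_iff inj_eq[OF b])
  qed
  with c show ?thesis by (meson inj_compose)
qed

text \<open>Interleaving real and imaginary parts reduces the complex case to the real one.\<close>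
lemma complex_seqs_inj_real: "\<exists>g :: (nat \<Rightarrow> complex) \<Rightarrow> real. inj g"
proof -
  obtain g :: "(nat \<Rightarrow> real) \<Rightarrow> real" where g: "inj g"
    using real_seqs_inj_real by blast
  define d where "d = (\<lambda>(a :: nat \<Rightarrow> complex) n. if even n then Re (a (n div 2)) else Im (a (n div 2)))"
  have "inj d"
  proof (rule injI)
    fix x y assume "d x = d y"
    then have "d x (2 * n) = d y (2 * n)" "d x (2 * n + 1) = d y (2 * n + 1)" for n by simp_all
    then show "x = y" by (auto simp: d_def fun_eq_iff complex_eq_iff)
  qed
  with g show ?thesis by (meson inj_compose)
qed

theorem theorem3p1:
  fixes p :: real
  assumes "0 < p" and "p < 1"
  shows
    "(let E = (ell p :: (real, nat \<Rightarrow> real) qspace); L = bounded_operators E E in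
        spaceable (qscale L) (qtopology L) |UNIV :: real set|
          (qcarrier L - \<Union>{summing_operators r s E E | r s. 1 \<le> s \<and> s \<le> r})) \<and>
     (let E = (ell p :: (complex, nat \<Rightarrow> complex) qspace); L = bounded_operators E E in
        spaceable (qscale L) (qtopology L) |UNIV :: real set|
          (qcarrier L - \<Union>{summing_operators r s E E | r s. 1 \<le> s \<and> s \<le> r}))"
proof -
  obtain g :: "(nat \<Rightarrow> real) \<Rightarrow> real" where g: "inj g"
    using real_seqs_inj_real by (rule exE)
  obtain g' :: "(nat \<Rightarrow> complex) \<Rightarrow> real" where g': "inj g'"
    using complex_seqs_inj_real by (rule exE)
  show ?thesis
    unfolding Let_def
    by (rule conjI[OF spaceable_non_summing[OF assms g] spaceable_non_summing[OF assms g']])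
qed

end
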